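(* Let $Q_n$ be the $k$-th order spline sieve MLE, HAL-MLE or relax HAL-MLE with (data dependent) working model $D^{(k)}(\mathcal R_{0,n})$, $\mathcal R_{0,n}=\mathcal R_n$. For $P\in\mathcal M$ let $Q_{\mathcal R_{0,n}}(P)=\arg\min_{Q\in D^{(k)}(\mathcal R_{0,n})}PL(Q)$, $Q_{0,n}=Q_{\mathcal R_{0,n}}(P_0)$, and let $\Phi_{0,n}:\mathcal M\to\mathbb R$, $\Phi_{0,n}(P)=\Phi(Q_{\mathcal R_{0,n}}(P))$. Let $D_{\mathcal R_{0,n},P}$ be the canonical gradient of $\Phi_{0,n}$ at $P$, and suppose it depends on $P$ through $Q(P)$ and a nuisance parameter $G(P)$, written $D_{\mathcal R_{0,n},Q,G}$. Let $R_{\Phi_{0,n}}(Q_n,Q_{0,n})=\Phi(Q_n)-\Phi(Q_{0,n})+P_0D_{\mathcal R_{0,n},Q_n,G_0}$ be the exact second order remainder. Assume: $P_0D_{\mathcal R_{0,n},Q_{0,n},G_0}=o_P(n^{-1/2})$; $P_nD_{\mathcal R_{0,n},Q_n,G_0}=o_P(n^{-1/2})$; $R_{\Phi_{0,n}}(Q_n,Q_{0,n})=o_P(n^{-1/2})$; $(P_n-P_0)\{D_{\mathcal R_{0,n},Q_n,G_0}-D_{\mathcal R_{0,n},Q_{0,n},G_0}\}=o_P(n^{-1/2})$; $P_0\{D_{\mathcal R_{0,n},Q_{0,n},G_0}-D_{\mathcal R_0,Q_0,G_0}\}^2\to_p0$ for a fixed $D_{\mathcal R_0,Q_0,G_0}\in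 L^2_0(P_0)$; and $D_{\mathcal R_{0,n},Q_{0,n},G_0}$ is an element of a $P_0$-Donsker class with probability tending to 1. Then $$\Phi(Q_n)-\Phi(Q_{0,n})=P_nD_{\mathcal R_0,Q_0,G_0}+o_P(n^{-1/2}).$$ If, in addition, $\Phi(Q_{0,n})-\Phi(Q_0)=o_P(n^{-1/2})$, then $$\Phi(Q_n)-\Phi(Q_0)=P_nD_{\mathcal R_0,Q_0,G_0}+o_P(n^{-1/2}).$$
   Context: $O_1,\dots,O_n$ i.i.d. from $P_0\in\mathcal M$, where $\mathcal M$ is the statistical model (e.g. nonparametric, or $\{p_Q:Q\in D^{(k)}([0,1]^d)\}$ with $D^{(k)}([0,1]^d)$ the functions with $k$-th order derivatives cadlag of bounded variation); $P_n$ empirical measure, $Pf=\int f\,dP$ (data-dependent index sets held fixed under $P_0$). $L(Q)(O)$ is a (log-likelihood behaving) loss with $Q(P)=\arg\min_QPL(Q)$, $Q_0=Q(P_0)$, $G_0=G(P_0)$. $\Phi$ is a real-valued parameter of $Q$ which is pathwise differentiable on $\mathcal M$. $L_0^2(P_0)$: square-integrable functions of mean zero under $P_0$. The canonical gradient is the Riesz representer, in the tangent space of $\mathcal M$ at $P$, of the pathwise derivative. Splines. For $s\subset\{1,\dots,d\}$, $x(s)=(x(j))_{j\in s}$, $s/s'$ is set difference. $\bar s(k+1)=(s_1,\dots,s_{k+1})$ with $s_{k+1}\subset\cdots\subset s_1\subset\{1,\dots,d\}$ (empty sets allowed). $\phi^j_u(x)=\prod_{l\in s}\frac{(x(l)-u(l))^j}{j!}I(x(l)\ge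 u(l))$ for $u,x\in[0,1]^s$. $\bar\phi_{\bar s(k+1)}(x)=\prod_{j=1}^{k}\phi^j_0(x(s_j/s_{j+1}))$ if $s_{k+1}\ne\emptyset$, and $\prod_{j=1}^{m}\phi^j_0(x(s_j/s_{j+1}))$ if $s_{k+1}=\emptyset$, $m\in\{0,\dots,k\}$ smallest with $s_{m+1}=\emptyset$. Basis functions indexed by $j$: $\phi_{(\bar s(k+1),u)}=\bar\phi_{\bar s(k+1)}(x)\phi^k_u(x(s_{k+1}))$ ($s_{k+1}\neq\emptyset$, $u\in(0(s_{k+1}),1(s_{k+1})]$) and $\phi_{\bar s(k+1)}=\bar\phi_{\bar s(k+1)}$ ($s_{k+1}=\emptyset$). For finite $\mathcal R$, $D^{(k)}(\mathcal R)=\{\sum_{j\in\mathcal R}\beta(j)\phi_j\}$, $D^{(k)}_C(\mathcal R)$ the subset with $\|\beta\|_1\le C$. Estimators. The sieve MLE minimizes $P_nL$ over $D^{(k)}(\mathcal R)$ for a data-adaptively selected member $\mathcal R$ of a prespecified family of finite index sets; the HAL-MLE minimizes $P_nL$ over $D^{(k)}_{C_n}(\mathcal R_{\max,n})$ for a large finite index set and data-adaptive $C_n$; the relax HAL-MLE minimizes $P_nL$ without penalty over $D^{(k)}$ of the indices with non-zero coefficient in the HAL-MLE. $\mathcal R_n$ is the set of indices with non-zero coefficient in $Q_n$. *)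

theory Defs
  imports "HOL-Probability.Probability"
begin

section \<open>Spline basis and working models\<close>

text \<open>
  Functions on the unit cube of dimension \<open>CARD('d)\<close> are represented as functions on
  \<open>real^'d\<close> that vanish outside the cube. An index \<open>(s, u)\<close> consists of the nested list
  \<open>s = [s_1, ..., s_{k+1}]\<close>, so that \<open>s_j\<close> is \<open>s ! (j - 1)\<close>, and of a knot point \<open>u\<close>.
  Only the coordinates of \<open>u\<close> in \<open>s_{k+1}\<close> carry information; the others are set to 0 so that
  each basis function has a single index (in particular \<open>u = 0\<close> if \<open>s_{k+1}\<close> is empty).
\<close>

type_synonym 'd spline_index = "'d set list \<times> (real ^ 'd)"

definition unit_cube :: "(real ^ 'd::finite) set" where
  "unit_cube = {x. \<forall>l. 0 \<le> x $ l \<and> x $ l \<le> 1}"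

definition truncated_power ::
    "nat \<Rightarrow> 'd set \<Rightarrow> real ^ 'd::finite \<Rightarrow> real ^ 'd \<Rightarrow> real" where
  "truncated_power j s u x =
     (\<Prod>l\<in>s. (x $ l - u $ l) ^ j / fact j * (if x $ l \<ge> u $ l then 1 else 0))"

definition spline_indices :: "nat \<Rightarrow> 'd::finite spline_index set" where
  "spline_indices k =
     {(s, u). length s = k + 1 \<and> (\<forall>j<k. s ! (j + 1) \<subseteq> s ! j) \<and>
              (\<forall>l\<in>s ! k. 0 < u $ l \<and> u $ l \<le> 1) \<and> (\<forall>l. l \<notin> s ! k \<longrightarrow> u $ l = 0)}"

definition spline_lower_factor :: "nat \<Rightarrow> 'd::finite set list \<Rightarrow> real ^ 'd \<Rightarrow> real" where
  "spline_lower_factor k s x =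
     (\<Prod>j = 1..(if s ! k \<noteq> {} then k else (LEAST m. s ! m = {})).
        truncated_power j (s ! (j - 1) - s ! j) 0 x)"

definition spline_basis :: "nat \<Rightarrow> 'd::finite spline_index \<Rightarrow> real ^ 'd \<Rightarrow> real" where
  "spline_basis k j x =
     (case j of (s, u) \<Rightarrow>
        indicator unit_cube x * spline_lower_factor k s x *
        (if s ! k \<noteq> {} then truncated_power k (s ! k) u x else 1))"

definition spline ::
    "nat \<Rightarrow> 'd::finite spline_index set \<Rightarrow> ('d spline_index \<Rightarrow> real) \<Rightarrow> real ^ 'd \<Rightarrow> real" where
  "spline k R \<beta> = (\<lambda>x. \<Sum>j\<in>R. \<beta> j * spline_basis k j x)"

definition spline_space ::
    "nat \<Rightarrow> 'd::finite spline_index set \<Rightarrow> (real ^ 'd \<Rightarrow> real) set" where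
  "spline_space k R = {spline k R \<beta> | \<beta>. True}"

definition spline_ball ::
    "nat \<Rightarrow> real \<Rightarrow> 'd::finite spline_index set \<Rightarrow> (real ^ 'd \<Rightarrow> real) set" where
  "spline_ball k C R = {spline k R \<beta> | \<beta>. (\<Sum>j\<in>R. \<bar>\<beta> j\<bar>) \<le> C}"

definition coef_support :: "('j \<Rightarrow> real) \<Rightarrow> 'j set" where
  "coef_support \<beta> = {j. \<beta> j \<noteq> 0}"


section \<open>Empirical and population risk minimization\<close>

definition emp_mean :: "nat \<Rightarrow> (nat \<Rightarrow> 'o) \<Rightarrow> ('o \<Rightarrow> real) \<Rightarrow> real" where
  "emp_mean n obs f = (\<Sum>i<n. f (obs i)) / real n"

text \<open>
  The risk takes values in the extended reals, because the Bochner integral of a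
  non-integrable loss would be 0. A risk minimizer is required to have finite risk.
\<close>

definition risk :: "'o measure \<Rightarrow> ('q \<Rightarrow> 'o \<Rightarrow> real) \<Rightarrow> 'q \<Rightarrow> ereal" where
  "risk P L q =
     enn2ereal (\<integral>\<^sup>+ x. ennreal (L q x) \<partial>P) - enn2ereal (\<integral>\<^sup>+ x. ennreal (- L q x) \<partial>P)"

definition risk_minimizer ::
    "'o measure \<Rightarrow> ('q \<Rightarrow> 'o \<Rightarrow> real) \<Rightarrow> 'q set \<Rightarrow> 'q \<Rightarrow> bool" where
  "risk_minimizer P L S q \<longleftrightarrow> integrable P (L q) \<and> is_arg_min (risk P L) (\<lambda>q. q \<in> S) q"

definition emp_risk_minimizer ::
    "nat \<Rightarrow> (nat \<Rightarrow> 'o) \<Rightarrow> ('q \<Rightarrow> 'o \<Rightarrow> real) \<Rightarrow> 'q set \<Rightarrow> 'q \<Rightarrow> bool" where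
  "emp_risk_minimizer n obs L S q \<longleftrightarrow>
     is_arg_min (\<lambda>q. emp_mean n obs (L q)) (\<lambda>q. q \<in> S) q"

text \<open>
  The basis functions need not be linearly independent, so that the set of indices with non-zero
  coefficient is a function of the fitted coefficient vector, not of the fitted function.
  The estimators are therefore described as coefficient vectors.
\<close>

definition sieve_mle ::
    "nat \<Rightarrow> (((real ^ 'd::finite) \<Rightarrow> real) \<Rightarrow> 'o \<Rightarrow> real) \<Rightarrow> nat \<Rightarrow> (nat \<Rightarrow> 'o) \<Rightarrow>
     'd spline_index set set \<Rightarrow> ('d spline_index \<Rightarrow> real) \<Rightarrow> bool" where
  "sieve_mle k L n obs Fam \<beta> \<longleftrightarrow>
     (\<forall>R\<in>Fam. finite R \<and> R \<subseteq> spline_indices k) \<and>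
     (\<exists>R\<in>Fam. coef_support \<beta> \<subseteq> R \<and>
        emp_risk_minimizer n obs L (spline_space k R) (spline k R \<beta>))"

definition hal_mle ::
    "nat \<Rightarrow> (((real ^ 'd::finite) \<Rightarrow> real) \<Rightarrow> 'o \<Rightarrow> real) \<Rightarrow> nat \<Rightarrow> (nat \<Rightarrow> 'o) \<Rightarrow>
     'd spline_index set \<Rightarrow> real \<Rightarrow> ('d spline_index \<Rightarrow> real) \<Rightarrow> bool" where
  "hal_mle k L n obs Rmax C \<beta> \<longleftrightarrow>
     finite Rmax \<and> Rmax \<subseteq> spline_indices k \<and>
     coef_support \<beta> \<subseteq> Rmax \<and> (\<Sum>j\<in>Rmax. \<bar>\<beta> j\<bar>) \<le> C \<and>
     emp_risk_minimizer n obs L (spline_ball k C Rmax) (spline k Rmax \<beta>)"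

definition relax_hal_mle ::
    "nat \<Rightarrow> (((real ^ 'd::finite) \<Rightarrow> real) \<Rightarrow> 'o \<Rightarrow> real) \<Rightarrow> nat \<Rightarrow> (nat \<Rightarrow> 'o) \<Rightarrow>
     'd spline_index set \<Rightarrow> real \<Rightarrow> ('d spline_index \<Rightarrow> real) \<Rightarrow> bool" where
  "relax_hal_mle k L n obs Rmax C \<beta> \<longleftrightarrow>
     (\<exists>\<alpha>. hal_mle k L n obs Rmax C \<alpha> \<and> coef_support \<beta> \<subseteq> coef_support \<alpha> \<and>
        emp_risk_minimizer n obs L (spline_space k (coef_support \<alpha>))
          (spline k (coef_support \<alpha>) \<beta>))"


section \<open>Pathwise differentiability and canonical gradients\<close>

definition L2 :: "'o measure \<Rightarrow> ('o \<Rightarrow> real) set" where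
  "L2 P = {f \<in> borel_measurable P. integrable P (\<lambda>x. (f x)\<^sup>2)}"

definition L2_0 :: "'o measure \<Rightarrow> ('o \<Rightarrow> real) set" where
  "L2_0 P = {f \<in> L2 P. (\<integral>x. f x \<partial>P) = 0}"

definition root_density :: "'o measure \<Rightarrow> 'o measure \<Rightarrow> 'o \<Rightarrow> real" where
  "root_density \<nu> P x = sqrt (enn2real (RN_deriv \<nu> P x))"

text \<open>
  A one-dimensional submodel through \<open>P\<close> that is differentiable in quadratic mean at 0 with
  score \<open>S\<close>. The integral below does not depend on the choice of the dominating measure
  \<open>\<nu> \<epsilon>\<close>, which may vary with \<open>\<epsilon>\<close>.
\<close>

definition dqm_path ::
    "'o measure set \<Rightarrow> 'o measure \<Rightarrow> (real \<Rightarrow> 'o measure) \<Rightarrow> ('o \<Rightarrow> real) \<Rightarrow> bool" where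
  "dqm_path Mod P p S \<longleftrightarrow>
     p 0 = P \<and> S \<in> L2_0 P \<and> (\<forall>\<^sub>F \<epsilon> in at 0. p \<epsilon> \<in> Mod) \<and>
     (\<exists>\<nu>. (\<forall>\<^sub>F \<epsilon> in at 0. sigma_finite_measure (\<nu> \<epsilon>) \<and> sets (\<nu> \<epsilon>) = sets P \<and>
               absolutely_continuous (\<nu> \<epsilon>) P \<and> absolutely_continuous (\<nu> \<epsilon>) (p \<epsilon>)) \<and>
          ((\<lambda>\<epsilon>. \<integral>\<^sup>+ x. ennreal
              (((root_density (\<nu> \<epsilon>) (p \<epsilon>) x - root_density (\<nu> \<epsilon>) P x) / \<epsilon>
                 - S x * root_density (\<nu> \<epsilon>) P x / 2)\<^sup>2) \<partial>\<nu> \<epsilon>) \<longlongrightarrow> 0) (at 0))"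

definition score_span :: "'o measure set \<Rightarrow> 'o measure \<Rightarrow> ('o \<Rightarrow> real) set" where
  "score_span Mod P =
     {(\<lambda>x. \<Sum>i<m. c i * S i x) | (m::nat) c S. \<forall>i<m. \<exists>p. dqm_path Mod P p (S i)}"

definition tangent_space :: "'o measure set \<Rightarrow> 'o measure \<Rightarrow> ('o \<Rightarrow> real) set" where
  "tangent_space Mod P =
     {f \<in> L2_0 P. \<forall>e>0. \<exists>g\<in>score_span Mod P. (\<integral>x. (f x - g x)\<^sup>2 \<partial>P) < e}"

definition pathwise_derivative ::
    "'o measure set \<Rightarrow> ('o measure \<Rightarrow> real) \<Rightarrow> 'o measure \<Rightarrow> (('o \<Rightarrow> real) \<Rightarrow> real) \<Rightarrow> bool" where
  "pathwise_derivative Mod \<Psi> P \<psi> \<longleftrightarrow>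
     (\<forall>f\<in>tangent_space Mod P. \<forall>g\<in>tangent_space Mod P. \<forall>a b.
        \<psi> (\<lambda>x. a * f x + b * g x) = a * \<psi> f + b * \<psi> g) \<and>
     (\<exists>K. \<forall>f\<in>tangent_space Mod P. \<bar>\<psi> f\<bar> \<le> K * sqrt (\<integral>x. (f x)\<^sup>2 \<partial>P)) \<and>
     (\<forall>p S. dqm_path Mod P p S \<longrightarrow> ((\<lambda>\<epsilon>. (\<Psi> (p \<epsilon>) - \<Psi> P) / \<epsilon>) \<longlongrightarrow> \<psi> S) (at 0))"

definition pathwise_differentiable ::
    "'o measure set \<Rightarrow> ('o measure \<Rightarrow> real) \<Rightarrow> 'o measure \<Rightarrow> bool" where
  "pathwise_differentiable Mod \<Psi> P \<longleftrightarrow> (\<exists>\<psi>. pathwise_derivative Mod \<Psi> P \<psi>)"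

definition canonical_gradient ::
    "'o measure set \<Rightarrow> ('o measure \<Rightarrow> real) \<Rightarrow> 'o measure \<Rightarrow> ('o \<Rightarrow> real) \<Rightarrow> bool" where
  "canonical_gradient Mod \<Psi> P D \<longleftrightarrow>
     D \<in> tangent_space Mod P \<and>
     (\<exists>\<psi>. pathwise_derivative Mod \<Psi> P \<psi> \<and>
          (\<forall>f\<in>tangent_space Mod P. \<psi> f = (\<integral>x. D x * f x \<partial>P)))"


section \<open>Stochastic order symbols\<close>

text \<open>
  Convergence in outer probability; for measurable maps this is convergence in probability.
\<close>

definition tendsto_0_in_prob :: "'w measure \<Rightarrow> (nat \<Rightarrow> 'w \<Rightarrow> ennreal) \<Rightarrow> bool" where
  "tendsto_0_in_prob M Z \<longleftrightarrow>
     (\<forall>e>0. (\<lambda>n. outer_measure_of M {\<omega> \<in> space M. Z n \<omega> > ennreal e}) \<longlonglongrightarrow> 0)"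

definition oP :: "'w measure \<Rightarrow> (nat \<Rightarrow> real) \<Rightarrow> (nat \<Rightarrow> 'w \<Rightarrow> real) \<Rightarrow> bool" where
  "oP M r Z \<longleftrightarrow> tendsto_0_in_prob M (\<lambda>n \<omega>. ennreal \<bar>Z n \<omega> / r n\<bar>)"

definition with_prob_tending_to_1 :: "'w measure \<Rightarrow> (nat \<Rightarrow> 'w \<Rightarrow> bool) \<Rightarrow> bool" where
  "with_prob_tending_to_1 M A \<longleftrightarrow>
     (\<lambda>n. outer_measure_of M {\<omega> \<in> space M. \<not> A n \<omega>}) \<longlonglongrightarrow> 0"


section \<open>Donsker classes\<close>

text \<open>
  Weak convergence in the sense of Hoffmann-Joergensen of the empirical process, as a map into
  the space of bounded functions on the class with the uniform metric, to a tight Borel law.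
  The observations are the coordinate projections on the infinite product space.
\<close>

definition outer_expectation :: "'w measure \<Rightarrow> ('w \<Rightarrow> real) \<Rightarrow> real" where
  "outer_expectation M h =
     Inf {(\<integral>\<omega>. U \<omega> \<partial>M) | U. integrable M U \<and> (\<forall>\<omega>\<in>space M. h \<omega> \<le> U \<omega>)}"

abbreviation linfty :: "'f set \<Rightarrow> ('f \<Rightarrow> real) metric" where
  "linfty F \<equiv> funspace F euclidean_metric"

definition borel_law :: "'a metric \<Rightarrow> 'a measure \<Rightarrow> bool" where
  "borel_law m \<mu> \<longleftrightarrow>
     prob_space \<mu> \<and> space \<mu> = mspace m \<and>
     sets \<mu> = sigma_sets (mspace m) {U. openin (mtopology_of m) U}"

definition tight_law :: "'a metric \<Rightarrow> 'a measure \<Rightarrow> bool" where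
  "tight_law m \<mu> \<longleftrightarrow>
     (\<forall>e>0. \<exists>K. compactin (mtopology_of m) K \<and> measure \<mu> K \<ge> 1 - e)"

definition weakly_converges_to ::
    "'w measure \<Rightarrow> 'a metric \<Rightarrow> (nat \<Rightarrow> 'w \<Rightarrow> 'a) \<Rightarrow> 'a measure \<Rightarrow> bool" where
  "weakly_converges_to M m X \<mu> \<longleftrightarrow>
     (\<forall>h. continuous_map (mtopology_of m) euclideanreal h \<and> bounded (h ` mspace m) \<longrightarrow>
          (\<lambda>n. outer_expectation M (\<lambda>\<omega>. h (X n \<omega>))) \<longlonglongrightarrow> (\<integral>z. h z \<partial>\<mu>))"

definition empirical_process ::
    "'o measure \<Rightarrow> ('o \<Rightarrow> real) set \<Rightarrow> nat \<Rightarrow> (nat \<Rightarrow> 'o) \<Rightarrow> ('o \<Rightarrow> real) \<Rightarrow> real" where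
  "empirical_process P F n obs = (\<lambda>f\<in>F. sqrt (real n) * (emp_mean n obs f - (\<integral>x. f x \<partial>P)))"

text \<open>
  The pointwise boundedness condition makes the sample paths of the empirical process bounded.
\<close>

definition donsker :: "'o measure \<Rightarrow> ('o \<Rightarrow> real) set \<Rightarrow> bool" where
  "donsker P F \<longleftrightarrow>
     (\<forall>f\<in>F. integrable P f) \<and>
     (\<forall>x\<in>space P. bounded ((\<lambda>f. f x - (\<integral>y. f y \<partial>P)) ` F)) \<and>
     (\<exists>\<mu>. borel_law (linfty F) \<mu> \<and> tight_law (linfty F) \<mu> \<and>
          weakly_converges_to (\<Pi>\<^sub>M i\<in>(UNIV::nat set). P) (linfty F)
            (empirical_process P F) \<mu>)"

end

theory Submission
  imports Defs
begin

text \<open>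
  Up to the negligible terms, \<open>\<Phi>(Q_n) - \<Phi>(Q_{0,n})\<close> is \<open>(P_n - P_0) D_{0,n}\<close> with
  \<open>D_{0,n}\<close> the gradient at \<open>Q_{0,n}\<close>, so what has to be shown is
  \<open>(P_n - P_0)(D_{0,n} - D_0) = o_P(n^{-1/2})\<close>, where \<open>D_0\<close> is the \<open>L2\<close> limit and need not
  lie in the Donsker class. By tightness, the empirical process is close, with high probability, to
  one of finitely many functions on the class, each the center of a ball of positive mass under the
  limit law. Weak convergence and Chebyshev's inequality force each of these functions to oscillate
  little among the members of the class that are \<open>L2\<close>-close to \<open>D_0\<close>. Hence \<open>D_{0,n}\<close> may be
  replaced by a fixed such member, which is compared with \<open>D_0\<close> by Chebyshev's inequality.
  All this takes place on the product space; outer probabilities only decrease when pulled back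
  along the sequence of observations.
\<close>

section \<open>Outer measure and outer expectation\<close>

text \<open>Each set has a measurable cover of the same outer measure, so subadditivity of the
  measure on the two covers suffices.\<close>

lemma outer_measure_of_Un_le:
  assumes "A \<subseteq> space M" "B \<subseteq> space M"
  shows "outer_measure_of M (A \<union> B) \<le> outer_measure_of M A + outer_measure_of M B"
proof -
  obtain E where E: "E \<in> sets M" "A \<subseteq> E" "outer_measure_of M A = emeasure M E"
    using outer_measure_of_attain[OF assms(1)] by blast
  obtain E' where E': "E' \<in> sets M" "B \<subseteq> E'" "outer_measure_of M B = emeasure M E'"
    using outer_measure_of_attain[OF assms(2)] by blast
  have "outer_measure_of M (A \<union> B) \<le> outer_measure_of M (E \<union> E')"
    using E E' by (intro outer_measure_of_mono) auto
  also have "\<dots> \<le> emeasure M E + emeasure M E'"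
    using E E' by (simp add: emeasure_subadditive)
  finally show ?thesis
    using E E' by simp
qed

text \<open>The preimage of a measurable cover of \<open>A\<close> is a measurable cover of the
  preimage of \<open>A\<close>. Only this inequality comes out of the argument, since the preimage
  of \<open>A\<close> may also have covers that are not preimages themselves.\<close>

lemma outer_measure_of_vimage_le:
  assumes T: "T \<in> measurable M N"
  shows "outer_measure_of M (T -` A \<inter> space M) \<le> outer_measure_of (distr M N T) A"
  unfolding outer_measure_of_def[of "distr M N T"]
proof (rule INF_greatest)
  fix B assume "B \<in> {B \<in> sets (distr M N T). A \<subseteq> B}"
  then have B: "B \<in> sets N" "A \<subseteq> B" by auto
  have "outer_measure_of M (T -` A \<inter> space M) \<le> outer_measure_of M (T -` B \<inter> space M)"
    using B by (intro outer_measure_of_mono) auto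
  also have "\<dots> = emeasure (distr M N T) B"
    using B T by (simp add: emeasure_distr measurable_sets)
  finally show "outer_measure_of M (T -` A \<inter> space M) \<le> emeasure (distr M N T) B" .
qed

text \<open>Nonnegativity of \<open>h\<close> bounds the integrals of all majorants below by 0, so
  that the real infimum is a genuine lower bound of each of them.\<close>

lemma outer_expectation_le_integral:
  assumes "integrable M U" "\<And>\<omega>. \<omega> \<in> space M \<Longrightarrow> 0 \<le> h \<omega>" "\<And>\<omega>. \<omega> \<in> space M \<Longrightarrow> h \<omega> \<le> U \<omega>"
  shows "outer_expectation M h \<le> (\<integral>\<omega>. U \<omega> \<partial>M)"
  unfolding outer_expectation_def
proof (rule cInf_lower)
  show "bdd_below {(\<integral>\<omega>. V \<omega> \<partial>M) |V. integrable M V \<and> (\<forall>\<omega>\<in>space M. h \<omega> \<le> V \<omega>)}"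
  proof (rule bdd_belowI[of _ 0])
    fix x assume "x \<in> {(\<integral>\<omega>. V \<omega> \<partial>M) |V. integrable M V \<and> (\<forall>\<omega>\<in>space M. h \<omega> \<le> V \<omega>)}"
    then obtain V where "x = (\<integral>\<omega>. V \<omega> \<partial>M)" "\<forall>\<omega>\<in>space M. h \<omega> \<le> V \<omega>" by auto
    with assms(2) show "0 \<le> x"
      by (auto intro!: Bochner_Integration.integral_nonneg intro: order_trans)
  qed
qed (use assms in auto)

text \<open>Markov's inequality at level 1, applied to an integrable majorant \<open>U\<close> of
  \<open>h\<close> whose integral is already below \<open>e\<close>. The constant \<open>B\<close>
  is a majorant, so the infimum is taken over a nonempty set and such a \<open>U\<close>
  exists.\<close>

lemma (in prob_space) outer_measure_of_less_if_outer_expectation_less: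
  assumes e: "outer_expectation M h < e"
    and h: "\<And>\<omega>. \<omega> \<in> space M \<Longrightarrow> 0 \<le> h \<omega>" "\<And>\<omega>. \<omega> \<in> space M \<Longrightarrow> h \<omega> \<le> B"
  shows "outer_measure_of M {\<omega> \<in> space M. h \<omega> \<ge> 1} < ennreal e"
proof -
  have "{(\<integral>\<omega>. U \<omega> \<partial>M) |U. integrable M U \<and> (\<forall>\<omega>\<in>space M. h \<omega> \<le> U \<omega>)} \<noteq> {}"
    using h(2) by (auto intro!: exI[of _ "\<lambda>_. B"])
  from cInf_lessD[OF this e[unfolded outer_expectation_def]]
  obtain U where U: "integrable M U" "\<forall>\<omega>\<in>space M. h \<omega> \<le> U \<omega>" "(\<integral>\<omega>. U \<omega> \<partial>M) < e"
    by auto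
  have U0: "0 \<le> U \<omega>" if "\<omega> \<in> space M" for \<omega>
    using U(2) h(1) that by (meson order_trans)
  have [measurable]: "U \<in> borel_measurable M" using U by auto
  have "outer_measure_of M {\<omega> \<in> space M. h \<omega> \<ge> 1} \<le> outer_measure_of M {\<omega> \<in> space M. U \<omega> \<ge> 1}"
    using U(2) by (intro outer_measure_of_mono) (auto intro: order_trans)
  also have "\<dots> = emeasure M {\<omega> \<in> space M. U \<omega> \<ge> 1}"
    by simp
  also have "\<dots> = (\<integral>\<^sup>+\<omega>. indicator {\<omega> \<in> space M. U \<omega> \<ge> 1} \<omega> \<partial>M)"
    by simp
  also have "\<dots> \<le> (\<integral>\<^sup>+\<omega>. ennreal (U \<omega>) \<partial>M)"
    by (intro nn_integral_mono) (auto simp: indicator_def U0 simp flip: ennreal_1)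
  also have "\<dots> = ennreal (\<integral>\<omega>. U \<omega> \<partial>M)"
    using U U0 by (intro nn_integral_eq_integral) auto
  also have "\<dots> < ennreal e"
  proof (rule ennreal_lessI)
    have "0 \<le> (\<integral>\<omega>. U \<omega> \<partial>M)"
      by (intro Bochner_Integration.integral_nonneg U0)
    with U(3) show "0 < e" by simp
  qed (rule U(3))
  finally show ?thesis .
qed

section \<open>Second moments of the empirical process\<close>

text \<open>\<open>Y n\<close> is independent of the partial sum before it and has mean zero, so the
  cross term has expectation zero. Integrability goes through the same induction, because
  independence makes the product integrable.\<close>

lemma (in prob_space) second_moment_sum_indep:
  fixes Y :: "nat \<Rightarrow> 'a \<Rightarrow> real"
  assumes indep: "indep_vars (\<lambda>_. borel) Y UNIV"
    and int: "\<And>i. integrable M (\<lambda>x. (Y i x)\<^sup>2)"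
    and mean: "\<And>i. expectation (Y i) = 0"
  shows "integrable M (\<lambda>x. (\<Sum>i<n. Y i x)\<^sup>2) \<and>
    expectation (\<lambda>x. (\<Sum>i<n. Y i x)\<^sup>2) = (\<Sum>i<n. expectation (\<lambda>x. (Y i x)\<^sup>2))"
proof (induction n)
  case (Suc n)
  have Y [measurable]: "Y i \<in> borel_measurable M" for i
    using indep unfolding indep_vars_def2 by simp
  have Yi: "integrable M (Y i)" for i
    by (rule square_integrable_imp_integrable[OF Y int])
  have ind: "indep_var borel (Y n) borel (\<lambda>x. \<Sum>i<n. Y i x)"
    using indep by (intro indep_vars_sum) (auto intro: indep_vars_subset)
  have int2: "integrable M (\<lambda>x. Y n x * (\<Sum>i<n. Y i x))"
    by (rule indep_var_integrable[OF ind]) (auto intro: Yi)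
  have e2: "expectation (\<lambda>x. Y n x * (\<Sum>i<n. Y i x)) = 0"
    by (subst indep_var_lebesgue_integral[OF ind]) (auto intro: Yi simp: mean)
  have eq: "(\<Sum>i<Suc n. Y i x)\<^sup>2 = (\<Sum>i<n. Y i x)\<^sup>2 + (Y n x)\<^sup>2 + 2 * (Y n x * (\<Sum>i<n. Y i x))" for x
    by (simp add: power2_eq_square algebra_simps)
  show ?case
    unfolding eq using Suc int int2 e2 by simp
qed simp

text \<open>The scaled and centered mean has the variance of a single \<open>h\<close>, which is at
  most its second moment. A bound on the nonnegative integral encodes square integrability together
  with its size.\<close>

lemma (in prob_space) variance_empirical_process_le:
  fixes h :: "'a \<Rightarrow> real"
  assumes h: "integrable M h" and B: "(\<integral>\<^sup>+ x. ennreal ((h x)\<^sup>2) \<partial>M) \<le> ennreal B" "0 \<le> B"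
  shows "integrable (\<Pi>\<^sub>M i\<in>(UNIV::nat set). M) (\<lambda>obs. (sqrt (real n) * (emp_mean n obs h - expectation h))\<^sup>2)"
      (is "?int")
    and "(\<integral>obs. (sqrt (real n) * (emp_mean n obs h - expectation h))\<^sup>2 \<partial>(\<Pi>\<^sub>M i\<in>(UNIV::nat set). M)) \<le> B"
      (is "?le")
proof -
  let ?PP = "\<Pi>\<^sub>M i\<in>(UNIV::nat set). M"
  interpret PP: prob_space ?PP
    by (intro prob_space_PiM prob_space_axioms)
  have hm [measurable]: "h \<in> borel_measurable M" using h by auto
  define m where "m = expectation h"
  have h2: "integrable M (\<lambda>x. (h x)\<^sup>2)"
    using B by (intro integrableI_bounded) (auto simp: power2_eq_square intro: le_less_trans)
  have dist: "distr ?PP M (\<lambda>x. x i) = M" for i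
    by (rule distr_PiM_component) (auto intro: prob_space_axioms)
  \<comment> \<open>The coordinates taken jointly are the identity map, whose law is the product of
    the coordinate laws; this characterizes independence.\<close>
  have ind: "PP.indep_vars (\<lambda>_. M) (\<lambda>i x. x i) UNIV"
    by (subst PP.indep_vars_iff_distr_eq_PiM) (auto simp: dist distr_id2 restrict_UNIV)
  define Y where "Y i x = h (x i) - m" for i and x :: "nat \<Rightarrow> 'a"
  have indY: "PP.indep_vars (\<lambda>_. borel) Y UNIV"
    unfolding Y_def by (rule PP.indep_vars_compose2[OF ind]) measurable
  have hm2: "integrable M (\<lambda>x. (h x - m)\<^sup>2)"
    using h h2 by (auto simp: power2_diff)
  have Y2: "integrable ?PP (\<lambda>x. (Y i x)\<^sup>2)" for i
    using hm2 unfolding Y_def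
    by (subst (asm) dist[of i, symmetric]) (simp add: integrable_distr_eq)
  have EY: "PP.expectation (Y i) = 0" for i
  proof -
    have "PP.expectation (Y i) = (\<integral>x. h x - m \<partial>distr ?PP M (\<lambda>x. x i))"
      unfolding Y_def by (simp add: integral_distr)
    also have "\<dots> = 0" using h by (simp add: dist m_def prob_space)
    finally show ?thesis .
  qed
  have EY2: "PP.expectation (\<lambda>x. (Y i x)\<^sup>2) \<le> B" for i
  proof -
    have "PP.expectation (\<lambda>x. (Y i x)\<^sup>2) = (\<integral>x. (h x - m)\<^sup>2 \<partial>distr ?PP M (\<lambda>x. x i))"
      unfolding Y_def by (simp add: integral_distr)
    also have "\<dots> = expectation (\<lambda>x. (h x)\<^sup>2) - m\<^sup>2"
      unfolding dist m_def using h h2 by (rule variance_eq)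
    also have "\<dots> \<le> expectation (\<lambda>x. (h x)\<^sup>2)" by simp
    also have "\<dots> \<le> B"
      using nn_integral_eq_integral[OF h2] B by (auto simp: ennreal_le_iff)
    finally show ?thesis .
  qed
  note S = PP.second_moment_sum_indep[OF indY Y2 EY, of n]
  \<comment> \<open>At \<open>n = 0\<close> both sides are 0, by \<open>sqrt 0 = 0\<close> and
    division by zero.\<close>
  have eq: "(sqrt (real n) * (emp_mean n x h - m))\<^sup>2 = (\<Sum>i<n. Y i x)\<^sup>2 / real n" for x
  proof (cases "n = 0")
    case False
    then have "emp_mean n x h - m = (\<Sum>i<n. Y i x) / real n"
      by (simp add: emp_mean_def Y_def sum_subtractf field_simps)
    then show ?thesis
      using False by (simp add: power_mult_distrib power_divide) (simp add: power2_eq_square)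
  qed simp
  show ?int
    unfolding m_def[symmetric] eq using S by simp
  have "PP.expectation (\<lambda>x. (\<Sum>i<n. Y i x)\<^sup>2 / real n) = (\<Sum>i<n. PP.expectation (\<lambda>x. (Y i x)\<^sup>2)) / real n"
    using S by simp
  also have "\<dots> \<le> B"
  proof (cases "n = 0")
    case False
    have "(\<Sum>i<n. PP.expectation (\<lambda>x. (Y i x)\<^sup>2)) \<le> (\<Sum>i<n. B)"
      by (intro sum_mono EY2)
    with False show ?thesis by (simp add: field_simps)
  qed (use B in simp)
  finally show ?le
    unfolding m_def[symmetric] eq .
qed

text \<open>Chebyshev's inequality: the indicator of the event is dominated by the square divided by
  \<open>\<delta>\<^sup>2\<close>.\<close>

lemma (in prob_space) empirical_process_tail_le:
  fixes h :: "'a \<Rightarrow> real"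
  assumes h: "integrable M h" and B: "(\<integral>\<^sup>+ x. ennreal ((h x)\<^sup>2) \<partial>M) \<le> ennreal B" "0 \<le> B" and "0 < \<delta>"
  shows "outer_measure_of (\<Pi>\<^sub>M i\<in>(UNIV::nat set). M)
     {obs \<in> space (\<Pi>\<^sub>M i\<in>(UNIV::nat set). M). \<bar>sqrt (real n) * (emp_mean n obs h - expectation h)\<bar> \<ge> \<delta>}
     \<le> ennreal (B / \<delta>\<^sup>2)" (is "outer_measure_of ?PP {obs \<in> _. \<bar>?G obs\<bar> \<ge> \<delta>} \<le> _")
proof -
  interpret PP: prob_space ?PP
    by (intro prob_space_PiM prob_space_axioms)
  have hm [measurable]: "h \<in> borel_measurable M" using h by auto
  have [measurable]: "(\<lambda>obs. emp_mean n obs h) \<in> borel_measurable ?PP"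
    unfolding emp_mean_def by measurable
  note V = variance_empirical_process_le[OF h B, of n]
  have "outer_measure_of ?PP {obs \<in> space ?PP. \<bar>?G obs\<bar> \<ge> \<delta>} = emeasure ?PP {obs \<in> space ?PP. \<bar>?G obs\<bar> \<ge> \<delta>}"
    by simp
  also have "\<dots> = (\<integral>\<^sup>+x. indicator {obs \<in> space ?PP. \<bar>?G obs\<bar> \<ge> \<delta>} x \<partial>?PP)"
    by simp
  also have "\<dots> \<le> (\<integral>\<^sup>+x. ennreal ((?G x)\<^sup>2 / \<delta>\<^sup>2) \<partial>?PP)"
  proof (intro nn_integral_mono)
    fix x
    have "1 \<le> (?G x)\<^sup>2 / \<delta>\<^sup>2" if "\<bar>?G x\<bar> \<ge> \<delta>"
      using that \<open>0 < \<delta>\<close> power_mono[of \<delta> "\<bar>?G x\<bar>" 2] by (simp only: power2_abs) simp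
    then show "indicator {obs \<in> space ?PP. \<bar>?G obs\<bar> \<ge> \<delta>} x \<le> ennreal ((?G x)\<^sup>2 / \<delta>\<^sup>2)"
      by (auto simp: indicator_def simp flip: ennreal_1 intro!: ennreal_leI)
  qed
  also have "\<dots> = ennreal (\<integral>x. (?G x)\<^sup>2 / \<delta>\<^sup>2 \<partial>?PP)"
    using V by (intro nn_integral_eq_integral) auto
  also have "\<dots> \<le> ennreal (B / \<delta>\<^sup>2)"
    using V \<open>0 < \<delta>\<close> by (intro ennreal_leI) (simp add: divide_right_mono)
  finally show ?thesis .
qed

section \<open>Bounded functions on a class and tight laws on them\<close>

text \<open>The test functions for weak convergence are built below from two kinds of 1-Lipschitz
  maps: the distance to a fixed point and the evaluation at a member of the class.\<close>

lemma continuous_map_if_Lipschitz_real: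
  fixes h :: "'a \<Rightarrow> real"
  assumes "\<And>x y. x \<in> mspace m \<Longrightarrow> y \<in> mspace m \<Longrightarrow> \<bar>h x - h y\<bar> \<le> mdist m x y"
  shows "continuous_map (mtopology_of m) euclideanreal h"
proof -
  have "Lipschitz_continuous_map m euclidean_metric h"
    using assms by (auto simp: Lipschitz_continuous_map_def dist_real_def intro!: exI[of _ 1])
  from Lipschitz_continuous_imp_continuous_map[OF this] show ?thesis by simp
qed

lemma continuous_map_mdist_const:
  assumes "a \<in> mspace m"
  shows "continuous_map (mtopology_of m) euclideanreal (\<lambda>z. mdist m a z)"
proof (rule continuous_map_if_Lipschitz_real)
  fix x y assume "x \<in> mspace m" "y \<in> mspace m"
  with assms show "\<bar>mdist m a x - mdist m a y\<bar> \<le> mdist m x y"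
    using mdist_triangle[of a m x y] mdist_triangle[of a m y x] mdist_commute[of m x y] by linarith
qed

lemma abs_diff_le_mdist_linfty:
  assumes "x \<in> mspace (linfty F)" "y \<in> mspace (linfty F)" "f \<in> F"
  shows "\<bar>x f - y f\<bar> \<le> mdist (linfty F) x y"
  using funspace_mdist_le[OF assms(1,2), of "mdist (linfty F) x y"] assms(3)
  by (auto simp: dist_real_def simp del: mdist_funspace)

lemma continuous_map_linfty_eval:
  assumes "f \<in> F"
  shows "continuous_map (mtopology_of (linfty F)) euclideanreal (\<lambda>z. z f)"
  by (rule continuous_map_if_Lipschitz_real) (rule abs_diff_le_mdist_linfty[OF _ _ assms])

text \<open>The bound over \<open>F\<close> at one observation may depend on that observation, but a
  path involves only \<open>n\<close> of them, and the average of their bounds works. Membership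
  also requires a path to be \<open>undefined\<close> off \<open>F\<close>, which the restriction to
  \<open>F\<close> in \<open>empirical_process\<close> provides.\<close>

lemma empirical_process_in_linfty:
  assumes bdd: "\<And>x. x \<in> space P \<Longrightarrow> bounded ((\<lambda>f. f x - (\<integral>y. f y \<partial>P)) ` F)"
    and obs: "\<And>i. obs i \<in> space P"
  shows "empirical_process P F n obs \<in> mspace (linfty F)"
proof -
  have "\<exists>b. \<forall>f\<in>F. \<bar>f (obs i) - (\<integral>y. f y \<partial>P)\<bar> \<le> b" for i
    using bdd[OF obs[of i]] by (auto simp: bounded_iff)
  then obtain b where b: "\<And>i f. f \<in> F \<Longrightarrow> \<bar>f (obs i) - (\<integral>y. f y \<partial>P)\<bar> \<le> b i"
    by metis
  have "\<bar>empirical_process P F n obs f\<bar> \<le> sqrt (real n) * ((\<Sum>i<n. b i) / real n)" if "f \<in> F" for f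
  proof (cases "n = 0")
    case False
    have "emp_mean n obs f - (\<integral>y. f y \<partial>P) = (\<Sum>i<n. f (obs i) - (\<integral>y. f y \<partial>P)) / real n"
      using False by (simp add: emp_mean_def sum_subtractf field_simps)
    moreover have "\<bar>\<Sum>i<n. f (obs i) - (\<integral>y. f y \<partial>P)\<bar> \<le> (\<Sum>i<n. b i)"
      by (intro order_trans[OF sum_abs] sum_mono b that)
    ultimately show ?thesis
      using that by (simp add: empirical_process_def abs_mult divide_right_mono mult_left_mono)
  qed (use that in \<open>simp add: empirical_process_def\<close>)
  then have "bounded (empirical_process P F n obs ` F)"
    by (auto simp: bounded_iff)
  moreover have "empirical_process P F n obs \<in> extensional F"
    by (simp add: empirical_process_def)
  ultimately show ?thesis
    by (simp add: Met_TC.fspace_def)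
qed

lemma borel_law_borel_measurable:
  assumes \<mu>: "borel_law m \<mu>" and h: "continuous_map (mtopology_of m) euclideanreal h"
  shows "h \<in> borel_measurable \<mu>"
proof (rule borel_measurableI)
  fix S :: "real set" assume "open S"
  then have "openin (mtopology_of m) {x \<in> topspace (mtopology_of m). h x \<in> S}"
    using h by (simp add: continuous_map_def)
  moreover have "{x \<in> topspace (mtopology_of m). h x \<in> S} = h -` S \<inter> space \<mu>"
    using \<mu> by (auto simp: borel_law_def)
  ultimately show "h -` S \<inter> space \<mu> \<in> sets \<mu>"
    using \<mu> by (auto simp: borel_law_def)
qed

lemma borel_law_mball_of:
  assumes \<mu>: "borel_law m \<mu>"
  shows "mball_of m a r \<in> sets \<mu>"
proof -
  have "openin (mtopology_of m) (mball_of m a r)"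
    by (simp add: mtopology_of_def mball_of_def Metric_space.openin_mball)
  then show ?thesis using \<mu> by (auto simp: borel_law_def)
qed

text \<open>
  The null balls of a finite net of a compact set may be dropped.
\<close>
lemma tight_law_finite_balls:
  assumes \<mu>: "borel_law m \<mu>" "tight_law m \<mu>" and "0 < \<delta>" "0 < \<epsilon>"
  obtains I where "finite I" "I \<subseteq> mspace m" "\<And>a. a \<in> I \<Longrightarrow> 0 < measure \<mu> (mball_of m a \<delta>)"
    "measure \<mu> (\<Union>a\<in>I. mball_of m a \<delta>) \<ge> 1 - \<epsilon>"
proof -
  interpret prob_space \<mu> using \<mu> by (simp add: borel_law_def)
  obtain K where K: "compactin (mtopology_of m) K" "measure \<mu> K \<ge> 1 - \<epsilon>"
    using \<mu>(2) \<open>0 < \<epsilon>\<close> unfolding tight_law_def by blast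
  interpret m: Metric_space "mspace m" "mdist m" by simp
  have "m.mtotally_bounded K"
    using K(1) by (simp add: mtopology_of_def m.compactin_imp_mtotally_bounded)
  \<comment> \<open>Total boundedness supplies a finite net whose centers lie in
    \<open>K\<close>.\<close>
  then obtain A where A: "finite A" "A \<subseteq> K" "K \<subseteq> (\<Union>a\<in>A. mball_of m a \<delta>)"
    using \<open>0 < \<delta>\<close> unfolding m.mtotally_bounded_def mball_of_def by meson
  have AM: "A \<subseteq> mspace m"
    using A(2) compactin_subset_topspace[OF K(1)] by auto
  define I where "I = {a \<in> A. 0 < measure \<mu> (mball_of m a \<delta>)}"
  have [measurable]: "mball_of m a \<delta> \<in> sets \<mu>" for a
    using \<mu>(1) by (rule borel_law_mball_of)
  have sI: "(\<Union>a\<in>I. mball_of m a \<delta>) \<in> sets \<mu>" "(\<Union>a\<in>A - I. mball_of m a \<delta>) \<in> sets \<mu>"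
    using A(1) by (auto simp: I_def intro!: sets.finite_UN)
  have "measure \<mu> (\<Union>a\<in>A - I. mball_of m a \<delta>) \<le> (\<Sum>a\<in>A - I. measure \<mu> (mball_of m a \<delta>))"
    using A(1) by (intro finite_measure_subadditive_finite) auto
  also have "\<dots> = 0"
    by (intro sum.neutral) (auto simp: I_def not_less measure_le_0_iff)
  finally have 0: "measure \<mu> (\<Union>a\<in>A - I. mball_of m a \<delta>) \<le> 0" .
  \<comment> \<open>Monotonicity asks for measurability of the larger set only.\<close>
  have "measure \<mu> K \<le> measure \<mu> ((\<Union>a\<in>I. mball_of m a \<delta>) \<union> (\<Union>a\<in>A - I. mball_of m a \<delta>))"
    using A(3) sI by (intro finite_measure_mono) auto
  also have "\<dots> \<le> measure \<mu> (\<Union>a\<in>I. mball_of m a \<delta>) + measure \<mu> (\<Union>a\<in>A - I. mball_of m a \<delta>)"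
    using sI by (intro measure_Un_le)
  finally have "measure \<mu> (\<Union>a\<in>I. mball_of m a \<delta>) \<ge> 1 - \<epsilon>"
    using 0 K(2) by linarith
  then show ?thesis
    using A(1) AM by (intro that[of I]) (auto simp: I_def)
qed

section \<open>Oscillation of the empirical process near an \<open>L2\<close> limit\<close>

text \<open>A triangle inequality for squared distances, with the factor 2 from (u - v)^2 \<le> 2
  u^2 + 2 v^2. Nonnegative integrals are used because members of a Donsker class are only known to
  be integrable.\<close>

lemma nn_integral_square_diff_le:
  fixes f g h :: "'a \<Rightarrow> real"
  assumes [measurable]: "f \<in> borel_measurable P" "g \<in> borel_measurable P" "h \<in> borel_measurable P"
    and "0 \<le> a" "0 \<le> b"
    and fa: "(\<integral>\<^sup>+ x. ennreal ((f x - h x)\<^sup>2) \<partial>P) \<le> ennreal a"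
    and gb: "(\<integral>\<^sup>+ x. ennreal ((g x - h x)\<^sup>2) \<partial>P) \<le> ennreal b"
  shows "(\<integral>\<^sup>+ x. ennreal ((f x - g x)\<^sup>2) \<partial>P) \<le> ennreal (2 * a + 2 * b)"
proof -
  have "(\<integral>\<^sup>+ x. ennreal ((f x - g x)\<^sup>2) \<partial>P)
      \<le> (\<integral>\<^sup>+ x. 2 * ennreal ((f x - h x)\<^sup>2) + 2 * ennreal ((g x - h x)\<^sup>2) \<partial>P)"
  proof (rule nn_integral_mono)
    fix x
    have "(f x - g x)\<^sup>2 \<le> 2 * (f x - h x)\<^sup>2 + 2 * (g x - h x)\<^sup>2"
      using sum_squares_bound[of "f x - h x" "- (g x - h x)"]
      by (simp add: power2_eq_square algebra_simps)
    then have "ennreal ((f x - g x)\<^sup>2) \<le> ennreal (2 * (f x - h x)\<^sup>2 + 2 * (g x - h x)\<^sup>2)"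
      by (rule ennreal_leI)
    then show "ennreal ((f x - g x)\<^sup>2) \<le> 2 * ennreal ((f x - h x)\<^sup>2) + 2 * ennreal ((g x - h x)\<^sup>2)"
      by (simp add: ennreal_plus ennreal_mult)
  qed
  also have "\<dots> = 2 * (\<integral>\<^sup>+ x. ennreal ((f x - h x)\<^sup>2) \<partial>P) + 2 * (\<integral>\<^sup>+ x. ennreal ((g x - h x)\<^sup>2) \<partial>P)"
    by (subst nn_integral_add) (auto simp: nn_integral_cmult)
  also have "\<dots> \<le> 2 * ennreal a + 2 * ennreal b"
    by (intro add_mono mult_left_mono fa gb) auto
  also have "\<dots> = ennreal (2 * a + 2 * b)"
    using \<open>0 \<le> a\<close> \<open>0 \<le> b\<close> by (simp add: ennreal_plus ennreal_mult)
  finally show ?thesis .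
qed

text \<open>
  No Gaussianity of the limit is used: if the center of a ball of positive mass took distant values
  at two elements of the class close to \<open>D0\<close> in \<open>L2\<close>, then Chebyshev's inequality in the limit
  would contradict the mass of the ball.
\<close>
lemma donsker_oscillation_at:
  fixes P :: "'o measure"
  assumes P: "prob_space P" and F: "donsker P F" and D0: "D0 \<in> borel_measurable P"
    and "0 < \<delta>" "0 < \<epsilon>"
  obtains e where "0 < e" "\<forall>\<^sub>F n in sequentially.
    outer_measure_of (\<Pi>\<^sub>M i\<in>(UNIV::nat set). P) {obs \<in> space (\<Pi>\<^sub>M i\<in>(UNIV::nat set). P).
      \<exists>f\<in>F. \<exists>g\<in>F. (\<integral>\<^sup>+ x. ennreal ((f x - D0 x)\<^sup>2) \<partial>P) \<le> ennreal e \<and>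
        (\<integral>\<^sup>+ x. ennreal ((g x - D0 x)\<^sup>2) \<partial>P) \<le> ennreal e \<and>
        \<bar>empirical_process P F n obs f - empirical_process P F n obs g\<bar> > \<delta>} < ennreal \<epsilon>"
proof -
  let ?PP = "\<Pi>\<^sub>M i\<in>(UNIV::nat set). P"
  let ?m = "linfty F"
  let ?G = "empirical_process P F"
  interpret P: prob_space P by fact
  interpret PP: prob_space ?PP by (intro prob_space_PiM P)
  \<comment> \<open>The budget is 7 = 2 + 3 + 2: a path within \<open>2 * d\<close> of a center at
    both \<open>f\<close> and \<open>g\<close>, and at most \<open>3 * d\<close> of oscillation of
    the center between them.\<close>
  define d where "d = \<delta> / 7"
  have "0 < d" using \<open>0 < \<delta>\<close> by (simp add: d_def)
  have Fint: "\<And>f. f \<in> F \<Longrightarrow> integrable P f"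
    and bdd: "\<And>x. x \<in> space P \<Longrightarrow> bounded ((\<lambda>f. f x - (\<integral>y. f y \<partial>P)) ` F)"
    using F unfolding donsker_def by auto
  obtain \<mu> where \<mu>: "borel_law ?m \<mu>" "tight_law ?m \<mu>" "weakly_converges_to ?PP ?m ?G \<mu>"
    using F unfolding donsker_def by auto
  interpret \<mu>: prob_space \<mu> using \<mu>(1) by (simp add: borel_law_def)
  have [measurable]: "mball_of ?m a r \<in> sets \<mu>" for a r
    using \<mu>(1) by (rule borel_law_mball_of)
  have G_in: "?G n obs \<in> mspace ?m" if "obs \<in> space ?PP" for n obs
    using that by (intro empirical_process_in_linfty bdd) (auto simp: space_PiM)
  have weak: "(\<lambda>n. outer_expectation ?PP (\<lambda>\<omega>. h (?G n \<omega>))) \<longlonglongrightarrow> (\<integral>z. h z \<partial>\<mu>)"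
    if "continuous_map (mtopology_of ?m) euclideanreal h" "\<And>z. 0 \<le> h z" "\<And>z. h z \<le> 1" for h
    using \<mu>(3) that unfolding weakly_converges_to_def by (auto simp: bounded_iff intro!: exI[of _ 1])
  have int: "integrable \<mu> h"
    if "continuous_map (mtopology_of ?m) euclideanreal h" "\<And>z. 0 \<le> h z" "\<And>z. h z \<le> 1" for h :: "_ \<Rightarrow> real"
    using that by (intro \<mu>.integrable_const_bound[of _ 1] borel_law_borel_measurable[OF \<mu>(1)]) auto
  obtain I where I: "finite I" "I \<subseteq> mspace ?m" "\<And>a. a \<in> I \<Longrightarrow> 0 < measure \<mu> (mball_of ?m a d)"
    "measure \<mu> (\<Union>a\<in>I. mball_of ?m a d) \<ge> 1 - \<epsilon> / 2"
    using tight_law_finite_balls[OF \<mu>(1,2) \<open>0 < d\<close>, of "\<epsilon> / 2"] \<open>0 < \<epsilon>\<close> by auto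
  \<comment> \<open>A positive lower bound for the masses of the finitely many balls; inserting 1
    keeps the minimum meaningful if \<open>I\<close> is empty.\<close>
  define c where "c = Min (insert 1 ((\<lambda>a. measure \<mu> (mball_of ?m a d)) ` I))"
  have "0 < c" using I(1,3) by (simp add: c_def)
  have c_le: "c \<le> measure \<mu> (mball_of ?m a d)" if "a \<in> I" for a
    using I(1) that by (simp add: c_def)
  \<comment> \<open>Two functions within \<open>e\<close> of \<open>D0\<close> are within
    \<open>4 * e\<close> of each other, and Chebyshev's bound \<open>4 * e / d\<^sup>2\<close> is
    then \<open>c / 2\<close>, below the mass of every ball.\<close>
  define e where "e = c * d\<^sup>2 / 8"
  have "0 < e" using \<open>0 < c\<close> \<open>0 < d\<close> by (simp add: e_def)
  let ?near = "\<lambda>f. (\<integral>\<^sup>+ x. ennreal ((f x - D0 x)\<^sup>2) \<partial>P) \<le> ennreal e"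

  have osc: "\<bar>a f - a g\<bar> \<le> 3 * d" if "a \<in> I" "f \<in> F" "g \<in> F" "?near f" "?near g" for a f g
  proof (rule ccontr)
    assume far: "\<not> \<bar>a f - a g\<bar> \<le> 3 * d"
    \<comment> \<open>A bounded continuous test function that is dominated by the square, whose mean
      is controlled, and equals 1 wherever \<open>z f\<close> and \<open>z g\<close> differ by at
      least \<open>d\<close>.\<close>
    define h where "h z = min 1 (((z f - z g) / d)\<^sup>2)" for z :: "('o \<Rightarrow> real) \<Rightarrow> real"
    have h: "continuous_map (mtopology_of ?m) euclideanreal h"
      unfolding h_def divide_inverse
      by (intro continuous_intros continuous_map_linfty_eval that) auto
    have h01: "0 \<le> h z" "h z \<le> 1" for z by (auto simp: h_def)
    have fg: "integrable P (\<lambda>x. f x - g x)" using Fint that by auto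
    have "(\<integral>\<^sup>+ x. ennreal ((f x - g x)\<^sup>2) \<partial>P) \<le> ennreal (2 * e + 2 * e)"
      using that Fint D0 \<open>0 < e\<close> by (intro nn_integral_square_diff_le[where h = D0]) auto
    then have near: "(\<integral>\<^sup>+ x. ennreal ((f x - g x)\<^sup>2) \<partial>P) \<le> ennreal (4 * e)" by simp
    have "outer_expectation ?PP (\<lambda>\<omega>. h (?G n \<omega>)) \<le> 4 * e / d\<^sup>2" for n
    proof -
      let ?U = "\<lambda>\<omega>. (sqrt (real n) * (emp_mean n \<omega> (\<lambda>x. f x - g x) - (\<integral>x. f x - g x \<partial>P)))\<^sup>2"
      note U = P.variance_empirical_process_le[OF fg near, of n]
      have "outer_expectation ?PP (\<lambda>\<omega>. h (?G n \<omega>)) \<le> (\<integral>\<omega>. ?U \<omega> / d\<^sup>2 \<partial>?PP)"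
      proof (rule outer_expectation_le_integral)
        fix \<omega>
        have "?G n \<omega> f - ?G n \<omega> g = sqrt (real n) * (emp_mean n \<omega> (\<lambda>x. f x - g x) - (\<integral>x. f x - g x \<partial>P))"
          using that Fint by (simp add: empirical_process_def emp_mean_def sum_subtractf
              right_diff_distrib diff_divide_distrib)
        then show "h (?G n \<omega>) \<le> ?U \<omega> / d\<^sup>2"
          by (simp add: h_def power_divide)
      qed (use U \<open>0 < e\<close> h01 in auto)
      also have "\<dots> \<le> 4 * e / d\<^sup>2"
        using U \<open>0 < e\<close> by (simp add: divide_right_mono)
      finally show ?thesis .
    qed
    \<comment> \<open>The variance bound is uniform in \<open>n\<close>, so it passes to the limit
      law.\<close>
    then have "(\<integral>z. h z \<partial>\<mu>) \<le> 4 * e / d\<^sup>2"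
      by (intro LIMSEQ_le_const2[OF weak[OF h h01]]) auto
    also have "\<dots> < c"
      using \<open>0 < c\<close> \<open>0 < d\<close> by (simp add: e_def)
    also have "c \<le> measure \<mu> (mball_of ?m a d)"
      using that by (intro c_le)
    also have "\<dots> = (\<integral>z. indicator (mball_of ?m a d) z \<partial>\<mu>)"
      by (simp add: Int_absorb2 sets.sets_into_space)
    also have "\<dots> \<le> (\<integral>z. h z \<partial>\<mu>)"
    proof (rule integral_mono[OF _ int[OF h h01]])
      show "integrable \<mu> (indicator (mball_of ?m a d) :: _ \<Rightarrow> real)"
        by (simp add: less_top[symmetric])
      fix z
      \<comment> \<open>Moving by less than \<open>d\<close> at each of \<open>f\<close> and
        \<open>g\<close> leaves more than \<open>d\<close> of the gap \<open>3 * d\<close> at the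
        center.\<close>
      have "h z = 1" if z: "z \<in> mball_of ?m a d"
      proof -
        have "\<bar>a f - z f\<bar> < d" "\<bar>a g - z g\<bar> < d"
          using z abs_diff_le_mdist_linfty[of a F z] \<open>f \<in> F\<close> \<open>g \<in> F\<close>
          by (auto simp del: mdist_funspace mspace_funspace intro: le_less_trans)
        with far have "1 \<le> \<bar>(z f - z g) / d\<bar>"
          using \<open>0 < d\<close> by (simp add: abs_divide)
        then have "1 \<le> ((z f - z g) / d)\<^sup>2"
          by (metis one_le_power power2_abs)
        then show ?thesis by (simp add: h_def)
      qed
      then show "indicator (mball_of ?m a d) z \<le> h z"
        using h01 by (auto simp: indicator_def)
    qed
    finally show False by simp
  qed

  \<comment> \<open>This continuous function vanishes on the balls of radius \<open>d\<close> and
    equals 1 at distance at least \<open>2 * d\<close> from all centers. Its integral is thus at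
    most the mass outside the balls, and it detects paths that stay away from every center.\<close>
  define h where "h z = (\<Prod>a\<in>I. min 1 (max 0 (mdist ?m a z / d - 1)))" for z
  have h: "continuous_map (mtopology_of ?m) euclideanreal h"
    unfolding h_def divide_inverse using I
    by (intro continuous_map_prod continuous_map_real_min continuous_map_real_max continuous_map_real_mult
        continuous_map_diff continuous_map_mdist_const) auto
  have h01: "0 \<le> h z" "h z \<le> 1" for z
    by (auto simp: h_def intro!: prod_nonneg prod_le_1)
  let ?V = "\<Union>a\<in>I. mball_of ?m a d"
  have V: "?V \<in> sets \<mu>" using I(1) by auto
  have "(\<integral>z. h z \<partial>\<mu>) \<le> (\<integral>z. indicator (space \<mu> - ?V) z \<partial>\<mu>)"
  proof (rule integral_mono[OF int[OF h h01]])
    show "integrable \<mu> (indicator (space \<mu> - ?V) :: _ \<Rightarrow> real)"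
      using V by (simp add: less_top[symmetric])
    fix z assume "z \<in> space \<mu>"
    moreover have "h z = 0" if "a \<in> I" "z \<in> mball_of ?m a d" for a
      unfolding h_def
    proof (rule prod_zero[OF I(1)], rule bexI[OF _ \<open>a \<in> I\<close>])
      have "mdist ?m a z / d - 1 \<le> 0"
        using that \<open>0 < d\<close> by (simp del: mdist_funspace)
      then show "min 1 (max 0 (mdist ?m a z / d - 1)) = 0"
        by linarith
    qed
    ultimately show "h z \<le> indicator (space \<mu> - ?V) z"
      using h01[of z] by (auto simp: indicator_def simp del: in_mball_of)
  qed
  also have "\<dots> = measure \<mu> (space \<mu> - ?V)"
    by (simp add: Int_absorb2)
  also have "\<dots> \<le> \<epsilon> / 2"
    using I(4) V \<mu>.prob_compl[of ?V] by simp
  also have "\<dots> < \<epsilon>" using \<open>0 < \<epsilon>\<close> by simp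
  finally have ev: "\<forall>\<^sub>F n in sequentially. outer_expectation ?PP (\<lambda>\<omega>. h (?G n \<omega>)) < \<epsilon>"
    using weak[OF h h01] by (simp add: order_tendstoD(2))
  show ?thesis
  proof (rule that[OF \<open>0 < e\<close>], use ev in eventually_elim)
    case (elim n)
    have "outer_measure_of ?PP {obs \<in> space ?PP. \<exists>f\<in>F. \<exists>g\<in>F. ?near f \<and> ?near g \<and> \<bar>?G n obs f - ?G n obs g\<bar> > \<delta>}
        \<le> outer_measure_of ?PP {obs \<in> space ?PP. h (?G n obs) \<ge> 1}"
    proof (intro outer_measure_of_mono subsetI CollectI conjI)
      fix obs assume *: "obs \<in> {obs \<in> space ?PP. \<exists>f\<in>F. \<exists>g\<in>F. ?near f \<and> ?near g \<and> \<bar>?G n obs f - ?G n obs g\<bar> > \<delta>}"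
      then show "obs \<in> space ?PP" by simp
      from * obtain f g where fg: "f \<in> F" "g \<in> F" "?near f" "?near g" "\<bar>?G n obs f - ?G n obs g\<bar> > 7 * d"
        by (auto simp: d_def)
      have Gm: "?G n obs \<in> mspace ?m" using * by (intro G_in) auto
      \<comment> \<open>A path closer than \<open>2 * d\<close> to a center would inherit an
        oscillation below \<open>7 * d\<close> from it.\<close>
      have "2 * d \<le> mdist ?m a (?G n obs)" if "a \<in> I" for a
      proof (rule ccontr)
        assume "\<not> 2 * d \<le> mdist ?m a (?G n obs)"
        moreover have "a \<in> mspace ?m" using I that by auto
        ultimately have "\<bar>a f - ?G n obs f\<bar> < 2 * d" "\<bar>a g - ?G n obs g\<bar> < 2 * d"
          using Gm abs_diff_le_mdist_linfty[of a F "?G n obs"] fg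
          by (meson le_less_trans not_le)+
        with osc[OF that fg(1-4)] fg(5) show False by linarith
      qed
      then have "1 \<le> mdist ?m a (?G n obs) / d - 1" if "a \<in> I" for a
        using that \<open>0 < d\<close> by (simp add: le_diff_eq pos_le_divide_eq del: mdist_funspace)
      then have "min 1 (max 0 (mdist ?m a (?G n obs) / d - 1)) = 1" if "a \<in> I" for a
        using that by (simp add: min_absorb1 max.coboundedI2 del: mdist_funspace)
      then show "h (?G n obs) \<ge> 1"
        unfolding h_def by simp
    qed
    also have "\<dots> < ennreal \<epsilon>"
      by (rule PP.outer_measure_of_less_if_outer_expectation_less[OF elim h01])
    finally show ?case .
  qed
qed

section \<open>Calculus of stochastic order symbols\<close>

lemma ennreal_tendsto_0_if_eventually_le:
  fixes X :: "'a \<Rightarrow> ennreal"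
  assumes "\<And>\<epsilon>::real. 0 < \<epsilon> \<Longrightarrow> \<forall>\<^sub>F n in A. X n \<le> ennreal \<epsilon>"
  shows "(X \<longlongrightarrow> 0) A"
proof (rule order_tendstoI)
  fix a :: ennreal assume "0 < a"
  then obtain b where b: "0 < b" "b < a" using dense by blast
  then obtain \<epsilon> where "b = ennreal \<epsilon>" "0 \<le> \<epsilon>" by (cases b) auto
  with b assms[of \<epsilon>] show "\<forall>\<^sub>F n in A. X n < a"
    by (auto elim!: eventually_mono simp: less_le)
qed simp

text \<open>A sum exceeds \<open>e\<close> only if a summand exceeds \<open>e / 2\<close>;
  subadditivity of the outer measure covers nonmeasurable terms.\<close>

lemma oP_add:
  assumes "oP M r Z" "oP M r W"
  shows "oP M r (\<lambda>n \<omega>. Z n \<omega> + W n \<omega>)"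
  unfolding oP_def tendsto_0_in_prob_def
proof (intro allI impI)
  fix e :: real assume "0 < e"
  let ?S = "\<lambda>Z n e. {\<omega> \<in> space M. ennreal e < ennreal \<bar>Z n \<omega> / r n\<bar>}"
  have "(\<lambda>n. outer_measure_of M (?S Z n (e / 2)) + outer_measure_of M (?S W n (e / 2))) \<longlonglongrightarrow> 0 + 0"
    using assms \<open>0 < e\<close> unfolding oP_def tendsto_0_in_prob_def
    by (intro tendsto_add) auto
  then have lim: "(\<lambda>n. outer_measure_of M (?S Z n (e / 2)) + outer_measure_of M (?S W n (e / 2))) \<longlonglongrightarrow> 0"
    by simp
  have "outer_measure_of M (?S (\<lambda>n \<omega>. Z n \<omega> + W n \<omega>) n e)
      \<le> outer_measure_of M (?S Z n (e / 2)) + outer_measure_of M (?S W n (e / 2))" for n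
  proof -
    have "?S (\<lambda>n \<omega>. Z n \<omega> + W n \<omega>) n e \<subseteq> ?S Z n (e / 2) \<union> ?S W n (e / 2)"
    proof
      fix \<omega> assume "\<omega> \<in> ?S (\<lambda>n \<omega>. Z n \<omega> + W n \<omega>) n e"
      then have "\<omega> \<in> space M" "e < \<bar>Z n \<omega> / r n + W n \<omega> / r n\<bar>"
        using \<open>0 < e\<close> by (auto simp: ennreal_less_iff add_divide_distrib)
      moreover from this have "e / 2 < \<bar>Z n \<omega> / r n\<bar> \<or> e / 2 < \<bar>W n \<omega> / r n\<bar>"
        by linarith
      ultimately show "\<omega> \<in> ?S Z n (e / 2) \<union> ?S W n (e / 2)"
        using \<open>0 < e\<close> by (auto simp: ennreal_less_iff simp del: abs_divide)
    qed
    then have "outer_measure_of M (?S (\<lambda>n \<omega>. Z n \<omega> + W n \<omega>) n e)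
        \<le> outer_measure_of M (?S Z n (e / 2) \<union> ?S W n (e / 2))"
      by (rule outer_measure_of_mono)
    also have "\<dots> \<le> outer_measure_of M (?S Z n (e / 2)) + outer_measure_of M (?S W n (e / 2))"
      by (rule outer_measure_of_Un_le) auto
    finally show ?thesis .
  qed
  then show "(\<lambda>n. outer_measure_of M (?S (\<lambda>n \<omega>. Z n \<omega> + W n \<omega>) n e)) \<longlonglongrightarrow> 0"
    by (intro tendsto_sandwich[OF _ _ tendsto_const lim] always_eventually) auto
qed

lemma oP_uminus: "oP M r Z \<Longrightarrow> oP M r (\<lambda>n \<omega>. - Z n \<omega>)"
  by (simp add: oP_def)

lemma oP_diff: "oP M r Z \<Longrightarrow> oP M r W \<Longrightarrow> oP M r (\<lambda>n \<omega>. Z n \<omega> - W n \<omega>)"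
  using oP_add[OF _ oP_uminus] by fastforce

text \<open>Agreement is asked for positive sample sizes only, since the estimators are constrained
  only there and the limit ignores \<open>n = 0\<close>.\<close>

lemma oP_cong:
  assumes "oP M r Z" "\<And>n \<omega>. 0 < n \<Longrightarrow> \<omega> \<in> space M \<Longrightarrow> W n \<omega> = Z n \<omega>"
  shows "oP M r W"
  unfolding oP_def tendsto_0_in_prob_def
proof (intro allI impI)
  fix e :: real assume "0 < e"
  have "\<forall>\<^sub>F n in sequentially. {\<omega> \<in> space M. ennreal e < ennreal \<bar>W n \<omega> / r n\<bar>}
      = {\<omega> \<in> space M. ennreal e < ennreal \<bar>Z n \<omega> / r n\<bar>}"
    using eventually_gt_at_top[of 0] by eventually_elim (auto simp: assms(2))
  then have "\<forall>\<^sub>F n in sequentially. outer_measure_of M {\<omega> \<in> space M. ennreal e < ennreal \<bar>W n \<omega> / r n\<bar>}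
      = outer_measure_of M {\<omega> \<in> space M. ennreal e < ennreal \<bar>Z n \<omega> / r n\<bar>}"
    by eventually_elim simp
  then show "(\<lambda>n. outer_measure_of M {\<omega> \<in> space M. ennreal e < ennreal \<bar>W n \<omega> / r n\<bar>}) \<longlonglongrightarrow> 0"
    using assms(1) \<open>0 < e\<close> by (simp add: tendsto_cong oP_def tendsto_0_in_prob_def)
qed

section \<open>Replacing the random gradient by its limit\<close>

text \<open>The exceptional event is covered by four events of outer probability at most
  \<open>\<epsilon> / 4\<close> each: \<open>f n \<omega>\<close> leaves \<open>F\<close>; it is far
  from \<open>D0\<close>; the process oscillates among members of \<open>F\<close> near
  \<open>D0\<close>; a fixed such member and \<open>D0\<close> are told apart by the
  process.\<close>

lemma donsker_consistent_empirical_process: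
  fixes f :: "nat \<Rightarrow> 'w \<Rightarrow> 'o \<Rightarrow> real"
  assumes M: "prob_space M" and P: "prob_space P"
    and iid: "prob_space.indep_vars M (\<lambda>_. P) Obs UNIV" "\<And>i. distr M P (Obs i) = P"
    and F: "donsker P F" and D0: "D0 \<in> L2 P"
    and f_in: "with_prob_tending_to_1 M (\<lambda>n \<omega>. f n \<omega> \<in> F)"
    and f_cons: "tendsto_0_in_prob M (\<lambda>n \<omega>. \<integral>\<^sup>+ x. ennreal ((f n \<omega> x - D0 x)\<^sup>2) \<partial>P)"
  shows "oP M (\<lambda>n. 1 / sqrt (real n)) (\<lambda>n \<omega>.
    (emp_mean n (\<lambda>i. Obs i \<omega>) (f n \<omega>) - (\<integral>x. f n \<omega> x \<partial>P)) -
    (emp_mean n (\<lambda>i. Obs i \<omega>) D0 - (\<integral>x. D0 x \<partial>P)))" (is "oP M _ ?Z")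
  unfolding oP_def tendsto_0_in_prob_def
proof (intro allI impI ennreal_tendsto_0_if_eventually_le)
  fix t \<epsilon> :: real assume "0 < t" "0 < \<epsilon>"
  let ?PP = "\<Pi>\<^sub>M i\<in>(UNIV::nat set). P"
  interpret M: prob_space M by fact
  interpret P: prob_space P by fact
  \<comment> \<open>\<open>T\<close> carries \<open>M\<close> to the product space on which the
    Donsker property is stated.\<close>
  define T where "T \<omega> = (\<lambda>i. Obs i \<omega>)" for \<omega>
  have Obs [measurable]: "Obs i \<in> measurable M P" for i
    using iid(1) unfolding M.indep_vars_def2 by simp
  have T: "T \<in> measurable M ?PP"
    unfolding T_def
    by (rule measurable_PiM_single'[OF Obs]) (simp add: Pi_iff PiE_iff measurable_space[OF Obs])
  have "distr M ?PP T = ?PP"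
    using iid(1) M.indep_vars_iff_distr_eq_PiM[where I = UNIV and M' = "\<lambda>_. P" and X = Obs]
    by (simp add: T_def[abs_def] restrict_UNIV iid(2))
  then have transfer: "outer_measure_of M (T -` A \<inter> space M) \<le> outer_measure_of ?PP A" for A
    using outer_measure_of_vimage_le[OF T, of A] by simp
  have D0m: "D0 \<in> borel_measurable P" and D0sq: "integrable P (\<lambda>x. (D0 x)\<^sup>2)"
    using D0 by (simp_all add: L2_def)
  note D0i = P.square_integrable_imp_integrable[OF D0m D0sq]
  have Fint: "\<And>g. g \<in> F \<Longrightarrow> integrable P g"
    using F unfolding donsker_def by auto
  define G where "G n obs g = sqrt (real n) * (emp_mean n obs g - (\<integral>x. g x \<partial>P))" for n obs g
  have G_F: "empirical_process P F n obs g = G n obs g" if "g \<in> F" for n obs g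
    using that by (simp add: empirical_process_def G_def)
  let ?dist = "\<lambda>g. \<integral>\<^sup>+ x. ennreal ((g x - D0 x)\<^sup>2) \<partial>P"
  obtain e' where e': "0 < e'" "\<forall>\<^sub>F n in sequentially. outer_measure_of ?PP {obs \<in> space ?PP.
      \<exists>f\<in>F. \<exists>g\<in>F. ?dist f \<le> ennreal e' \<and> ?dist g \<le> ennreal e' \<and>
        \<bar>empirical_process P F n obs f - empirical_process P F n obs g\<bar> > t / 2} < ennreal (\<epsilon> / 4)"
    by (rule donsker_oscillation_at[OF P F D0m, of "t / 2" "\<epsilon> / 4"]) (use \<open>0 < t\<close> \<open>0 < \<epsilon>\<close> in auto)
  \<comment> \<open>The first entry makes the oscillation bound applicable; the second makes
    Chebyshev's bound \<open>e / (t / 2)\<^sup>2\<close> at most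
    \<open>\<epsilon> / 4\<close>.\<close>
  define e where "e = min e' (\<epsilon> / 4 * (t / 2)\<^sup>2)"
  have e: "0 < e" "e \<le> e'" "e / (t / 2)\<^sup>2 \<le> \<epsilon> / 4"
    using \<open>0 < t\<close> \<open>0 < \<epsilon>\<close> e'(1) by (auto simp: e_def pos_divide_le_eq)
  have ev1: "\<forall>\<^sub>F n in sequentially. outer_measure_of M {\<omega> \<in> space M. f n \<omega> \<notin> F} < ennreal (\<epsilon> / 4)"
    using f_in \<open>0 < \<epsilon>\<close> unfolding with_prob_tending_to_1_def by (intro order_tendstoD(2)) auto
  have ev2: "\<forall>\<^sub>F n in sequentially. outer_measure_of M {\<omega> \<in> space M. ennreal e < ?dist (f n \<omega>)} < ennreal (\<epsilon> / 4)"
    using f_cons \<open>0 < \<epsilon>\<close> e(1) unfolding tendsto_0_in_prob_def by (intro order_tendstoD(2)) auto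
  show "\<forall>\<^sub>F n in sequentially. outer_measure_of M
      {\<omega> \<in> space M. ennreal t < ennreal \<bar>?Z n \<omega> / (1 / sqrt (real n))\<bar>} \<le> ennreal \<epsilon>"
    using e'(2) ev1 ev2
  proof eventually_elim
    case (elim n)
    have Z: "?Z n \<omega> / (1 / sqrt (real n)) = G n (T \<omega>) (f n \<omega>) - G n (T \<omega>) D0" for \<omega>
      by (simp add: G_def T_def algebra_simps)
    let ?A = "{\<omega> \<in> space M. f n \<omega> \<notin> F}" and ?B = "{\<omega> \<in> space M. ennreal e < ?dist (f n \<omega>)}"
    let ?C = "{obs \<in> space ?PP. \<exists>f\<in>F. \<exists>g\<in>F. ?dist f \<le> ennreal e' \<and> ?dist g \<le> ennreal e' \<and>
        \<bar>empirical_process P F n obs f - empirical_process P F n obs g\<bar> > t / 2}"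
    obtain E where E: "E \<subseteq> space ?PP" "outer_measure_of ?PP E \<le> ennreal (\<epsilon> / 4)"
      and bad: "{\<omega> \<in> space M. ennreal t < ennreal \<bar>?Z n \<omega> / (1 / sqrt (real n))\<bar>}
        \<subseteq> ?A \<union> ?B \<union> (T -` ?C \<inter> space M \<union> T -` E \<inter> space M)"
    proof (cases "\<exists>g\<in>F. ?dist g \<le> ennreal e")
      \<comment> \<open>If no member of \<open>F\<close> is within \<open>e\<close> of
        \<open>D0\<close>, then \<open>f n \<omega>\<close> is outside \<open>F\<close> or far from
        \<open>D0\<close>, so \<open>?A\<close> and \<open>?B\<close> already cover
        everything.\<close>
      case False
      show ?thesis
        by (rule that[of "{}"]) (use False in auto)
    next
      case True
      \<comment> \<open>Unlike \<open>f n \<omega>\<close>, this \<open>g\<close> is not random, so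
        Chebyshev's inequality applies to \<open>g - D0\<close>.\<close>
      then obtain g where g: "g \<in> F" "?dist g \<le> ennreal e" by blast
      have gD: "integrable P (\<lambda>x. g x - D0 x)"
        using Fint[OF g(1)] D0i by auto
      let ?E = "{obs \<in> space ?PP. \<bar>G n obs (\<lambda>x. g x - D0 x)\<bar> \<ge> t / 2}"
      show ?thesis
      proof (rule that[of ?E])
        show "outer_measure_of ?PP ?E \<le> ennreal (\<epsilon> / 4)"
          unfolding G_def using e \<open>0 < t\<close>
          by (intro order_trans[OF P.empirical_process_tail_le[OF gD g(2)]] ennreal_leI) auto
        show "{\<omega> \<in> space M. ennreal t < ennreal \<bar>?Z n \<omega> / (1 / sqrt (real n))\<bar>}
          \<subseteq> ?A \<union> ?B \<union> (T -` ?C \<inter> space M \<union> T -` ?E \<inter> space M)"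
        proof (rule subsetI, rule ccontr)
          fix \<omega> assume bad: "\<omega> \<in> {\<omega> \<in> space M. ennreal t < ennreal \<bar>?Z n \<omega> / (1 / sqrt (real n))\<bar>}"
            and "\<omega> \<notin> ?A \<union> ?B \<union> (T -` ?C \<inter> space M \<union> T -` ?E \<inter> space M)"
          then have \<omega>: "\<omega> \<in> space M" "f n \<omega> \<in> F" "?dist (f n \<omega>) \<le> ennreal e"
            "T \<omega> \<notin> ?C" "T \<omega> \<notin> ?E" by (auto simp: not_less)
          have far: "t < \<bar>G n (T \<omega>) (f n \<omega>) - G n (T \<omega>) D0\<bar>"
            using bad \<open>0 < t\<close> unfolding Z by (simp add: ennreal_less_iff)
          have Tsp: "T \<omega> \<in> space ?PP" using measurable_space[OF T \<omega>(1)] .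
          have le: "ennreal e \<le> ennreal e'" using e by (intro ennreal_leI) auto
          have "\<bar>G n (T \<omega>) (f n \<omega>) - G n (T \<omega>) g\<bar> \<le> t / 2"
            using \<omega>(2-4) g Tsp order_trans[OF _ le]
            by (auto simp: G_F not_less simp del: ennreal_le_iff)
          moreover have "G n (T \<omega>) (\<lambda>x. g x - D0 x) = G n (T \<omega>) g - G n (T \<omega>) D0"
            using Fint[OF g(1)] D0i by (simp add: G_def emp_mean_def sum_subtractf
              right_diff_distrib diff_divide_distrib)
          then have "\<bar>G n (T \<omega>) g - G n (T \<omega>) D0\<bar> < t / 2"
            using \<omega>(5) Tsp by auto
          ultimately show False using far by linarith
        qed
      qed auto
    qed
    have "outer_measure_of M {\<omega> \<in> space M. ennreal t < ennreal \<bar>?Z n \<omega> / (1 / sqrt (real n))\<bar>}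
        \<le> outer_measure_of M (?A \<union> ?B \<union> (T -` ?C \<inter> space M \<union> T -` E \<inter> space M))"
      by (rule outer_measure_of_mono[OF bad])
    also have "\<dots> \<le> (outer_measure_of M ?A + outer_measure_of M ?B) +
        (outer_measure_of M (T -` ?C \<inter> space M) + outer_measure_of M (T -` E \<inter> space M))"
      by (intro order_trans[OF outer_measure_of_Un_le] add_mono) (auto intro: outer_measure_of_Un_le)
    also have "\<dots> \<le> (ennreal (\<epsilon> / 4) + ennreal (\<epsilon> / 4)) + (ennreal (\<epsilon> / 4) + ennreal (\<epsilon> / 4))"
      using elim E(2) by (intro add_mono order_trans[OF transfer]) auto
    also have "\<dots> = ennreal \<epsilon>"
      using \<open>0 < \<epsilon>\<close> by (simp flip: ennreal_plus)
    finally show ?case .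
  qed
qed

section \<open>The asymptotic expansion\<close>

theorem theorem14:
  fixes M :: "'w measure"
    and Obs :: "nat \<Rightarrow> 'w \<Rightarrow> 'o"
    and Mod :: "'o measure set" and P0 :: "'o measure"
    and k :: nat
    and L :: "(real ^ 'd::finite \<Rightarrow> real) \<Rightarrow> 'o \<Rightarrow> real"
    and Qspace :: "(real ^ 'd \<Rightarrow> real) set"
    and Q :: "'o measure \<Rightarrow> (real ^ 'd \<Rightarrow> real)"
    and G :: "'o measure \<Rightarrow> 'g"
    and \<Phi> :: "(real ^ 'd \<Rightarrow> real) \<Rightarrow> real"
    and Fam :: "nat \<Rightarrow> 'd spline_index set set"
    and Rmax :: "nat \<Rightarrow> 'w \<Rightarrow> 'd spline_index set" and C :: "nat \<Rightarrow> 'w \<Rightarrow> real"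
    and \<beta> :: "nat \<Rightarrow> 'w \<Rightarrow> 'd spline_index \<Rightarrow> real"
    and Rn :: "nat \<Rightarrow> 'w \<Rightarrow> 'd spline_index set"
    and Qn Q0n :: "nat \<Rightarrow> 'w \<Rightarrow> real ^ 'd \<Rightarrow> real"
    and QR :: "'d spline_index set \<Rightarrow> 'o measure \<Rightarrow> (real ^ 'd \<Rightarrow> real)"
    and D :: "'d spline_index set \<Rightarrow> (real ^ 'd \<Rightarrow> real) \<Rightarrow> 'g \<Rightarrow> 'o \<Rightarrow> real"
    and Q0 :: "real ^ 'd \<Rightarrow> real" and G0 :: 'g
    and D0 :: "'o \<Rightarrow> real"
    and Pn :: "nat \<Rightarrow> 'w \<Rightarrow> ('o \<Rightarrow> real) \<Rightarrow> real"
  assumes prob: "prob_space M"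
    and model: "\<forall>P\<in>Mod. prob_space P \<and> sets P = sets P0"
    and truth: "P0 \<in> Mod"
    and iid: "prob_space.indep_vars M (\<lambda>_. P0) Obs UNIV" "\<forall>i. distr M P0 (Obs i) = P0"
    and Pn: "Pn = (\<lambda>n \<omega>. emp_mean n (\<lambda>i. Obs i \<omega>))"
    and Q: "\<forall>P\<in>Mod. risk_minimizer P L Qspace (Q P)"
    and Q0: "Q0 = Q P0"
    and G0: "G0 = G P0"
    and Phi: "\<forall>P\<in>Mod. pathwise_differentiable Mod (\<lambda>P. \<Phi> (Q P)) P"
    and estimator:
      "(\<forall>n>0. \<forall>\<omega>\<in>space M. sieve_mle k L n (\<lambda>i. Obs i \<omega>) (Fam n) (\<beta> n \<omega>)) \<or>
       (\<forall>n>0. \<forall>\<omega>\<in>space M. hal_mle k L n (\<lambda>i. Obs i \<omega>) (Rmax n \<omega>) (C n \<omega>) (\<beta> n \<omega>)) \<or>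
       (\<forall>n>0. \<forall>\<omega>\<in>space M. relax_hal_mle k L n (\<lambda>i. Obs i \<omega>) (Rmax n \<omega>) (C n \<omega>) (\<beta> n \<omega>))"
    and Rn: "Rn = (\<lambda>n \<omega>. coef_support (\<beta> n \<omega>))"
    and Qn: "Qn = (\<lambda>n \<omega>. spline k (Rn n \<omega>) (\<beta> n \<omega>))"
    and QR: "\<forall>n>0. \<forall>\<omega>\<in>space M. \<forall>P\<in>Mod.
      risk_minimizer P L (spline_space k (Rn n \<omega>)) (QR (Rn n \<omega>) P)"
    and Q0n: "Q0n = (\<lambda>n \<omega>. QR (Rn n \<omega>) P0)"
    and gradient: "\<forall>n>0. \<forall>\<omega>\<in>space M. \<forall>P\<in>Mod.
      canonical_gradient Mod (\<lambda>P. \<Phi> (QR (Rn n \<omega>) P)) P (D (Rn n \<omega>) (Q P) (G P))"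
    and integrable: "\<forall>n>0. \<forall>\<omega>\<in>space M.
      integrable P0 (D (Rn n \<omega>) (Qn n \<omega>) G0) \<and> integrable P0 (D (Rn n \<omega>) (Q0n n \<omega>) G0)"
    and approx_score: "oP M (\<lambda>n. 1 / sqrt (real n))
      (\<lambda>n \<omega>. \<integral>x. D (Rn n \<omega>) (Q0n n \<omega>) G0 x \<partial>P0)"
    and emp_score: "oP M (\<lambda>n. 1 / sqrt (real n))
      (\<lambda>n \<omega>. Pn n \<omega> (D (Rn n \<omega>) (Qn n \<omega>) G0))"
    and remainder: "oP M (\<lambda>n. 1 / sqrt (real n))
      (\<lambda>n \<omega>. \<Phi> (Qn n \<omega>) - \<Phi> (Q0n n \<omega>) + (\<integral>x. D (Rn n \<omega>) (Qn n \<omega>) G0 x \<partial>P0))"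
    and equicont: "oP M (\<lambda>n. 1 / sqrt (real n))
      (\<lambda>n \<omega>. Pn n \<omega> (\<lambda>x. D (Rn n \<omega>) (Qn n \<omega>) G0 x - D (Rn n \<omega>) (Q0n n \<omega>) G0 x)
             - (\<integral>x. D (Rn n \<omega>) (Qn n \<omega>) G0 x - D (Rn n \<omega>) (Q0n n \<omega>) G0 x \<partial>P0))"
    and D0: "D0 \<in> L2_0 P0"
    and L2_consistent: "tendsto_0_in_prob M
      (\<lambda>n \<omega>. \<integral>\<^sup>+ x. ennreal ((D (Rn n \<omega>) (Q0n n \<omega>) G0 x - D0 x)\<^sup>2) \<partial>P0)"
    and donsker: "\<exists>F. donsker P0 F \<and>
      with_prob_tending_to_1 M (\<lambda>n \<omega>. D (Rn n \<omega>) (Q0n n \<omega>) G0 \<in> F)"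
  shows "oP M (\<lambda>n. 1 / sqrt (real n))
           (\<lambda>n \<omega>. \<Phi> (Qn n \<omega>) - \<Phi> (Q0n n \<omega>) - Pn n \<omega> D0) \<and>
         (oP M (\<lambda>n. 1 / sqrt (real n)) (\<lambda>n \<omega>. \<Phi> (Q0n n \<omega>) - \<Phi> Q0) \<longrightarrow>
          oP M (\<lambda>n. 1 / sqrt (real n)) (\<lambda>n \<omega>. \<Phi> (Qn n \<omega>) - \<Phi> Q0 - Pn n \<omega> D0))"
proof -
  have P0: "prob_space P0" using model truth by blast
  obtain F where F: "donsker P0 F"
    "with_prob_tending_to_1 M (\<lambda>n \<omega>. D (Rn n \<omega>) (Q0n n \<omega>) G0 \<in> F)"
    using donsker by blast
  have D0_L2: "D0 \<in> L2 P0" and D0_mean: "(\<integral>x. D0 x \<partial>P0) = 0"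
    using D0 by (auto simp: L2_0_def)
  note emp = donsker_consistent_empirical_process[OF prob P0 iid(1) iid(2)[rule_format] F(1) D0_L2 F(2)
    L2_consistent]
  have first: "oP M (\<lambda>n. 1 / sqrt (real n))
      (\<lambda>n \<omega>. \<Phi> (Qn n \<omega>) - \<Phi> (Q0n n \<omega>) - Pn n \<omega> D0)"
  \<comment> \<open>The four terms telescope: remainder, minus empirical score, plus the empirical
    process at the difference of the gradients at \<open>Qn\<close> and \<open>Q0n\<close>, plus
    that at the difference of the gradient at \<open>Q0n\<close> and \<open>D0\<close>.
    Integrability of both gradients splits the integral of their difference, and the mean of
    \<open>D0\<close> is zero.\<close>
  proof (rule oP_cong[OF oP_add[OF oP_add[OF oP_diff[OF remainder emp_score] equicont] emp]])
    fix n :: nat and \<omega> assume "0 < n" "\<omega> \<in> space M"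
    then have "integrable P0 (D (Rn n \<omega>) (Qn n \<omega>) G0)" "integrable P0 (D (Rn n \<omega>) (Q0n n \<omega>) G0)"
      using integrable by auto
    moreover have "Pn n \<omega> (\<lambda>x. f x - g x) = Pn n \<omega> f - Pn n \<omega> g" for f g
      by (simp add: Pn emp_mean_def sum_subtractf diff_divide_distrib)
    ultimately show "\<Phi> (Qn n \<omega>) - \<Phi> (Q0n n \<omega>) - Pn n \<omega> D0 =
      \<Phi> (Qn n \<omega>) - \<Phi> (Q0n n \<omega>) + (\<integral>x. D (Rn n \<omega>) (Qn n \<omega>) G0 x \<partial>P0) -
      Pn n \<omega> (D (Rn n \<omega>) (Qn n \<omega>) G0) +
      (Pn n \<omega> (\<lambda>x. D (Rn n \<omega>) (Qn n \<omega>) G0 x - D (Rn n \<omega>) (Q0n n \<omega>) G0 x) -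
        (\<integral>x. D (Rn n \<omega>) (Qn n \<omega>) G0 x - D (Rn n \<omega>) (Q0n n \<omega>) G0 x \<partial>P0)) +
      (emp_mean n (\<lambda>i. Obs i \<omega>) (D (Rn n \<omega>) (Q0n n \<omega>) G0) -
        (\<integral>x. D (Rn n \<omega>) (Q0n n \<omega>) G0 x \<partial>P0) -
        (emp_mean n (\<lambda>i. Obs i \<omega>) D0 - (\<integral>x. D0 x \<partial>P0)))"
      using D0_mean by (simp add: Pn)
  qed
  show ?thesis
  proof (intro conjI impI first)
    assume "oP M (\<lambda>n. 1 / sqrt (real n)) (\<lambda>n \<omega>. \<Phi> (Q0n n \<omega>) - \<Phi> Q0)"
    from oP_add[OF first this]
    show "oP M (\<lambda>n. 1 / sqrt (real n)) (\<lambda>n \<omega>. \<Phi> (Qn n \<omega>) - \<Phi> Q0 - Pn n \<omega> D0)"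
      by (rule oP_cong) simp
  qed
qed

end
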